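(* Let $\kappa<\lambda$ be uncountable cardinals with $\lambda$ regular, and suppose there is a full $\square(\lambda,<\kappa)$-sequence. Then $\mathrm{Refl}(<\kappa,S)$ fails for every stationary $S\subseteq\lambda$.
   Context: For a set of ordinals $A$, $\mathrm{acc}(A)$ is the set of $\beta<\sup\{\alpha+1\mid\alpha\in A\}$ with $\beta=\sup(A\cap\beta)$. A coherent sequence of length $\lambda$ and width $<\eta$ is $\mathcal{C}=\langle\mathcal{C}_\alpha\mid\alpha<\lambda\rangle$ where each $\mathcal{C}_\alpha$ is a nonempty set of fewer than $\eta$ closed unbounded subsets of $\alpha$ (for successor $\alpha=\beta+1$, $\mathcal{C}_\alpha=\{\{\beta\}\}$), such that for all $\beta<\lambda$, $C\in\mathcal{C}_\beta$ and $\alpha\in\mathrm{acc}(C)$, $C\cap\alpha\in\mathcal{C}_\alpha$. A thread is a club $D\subseteq\lambda$ with $D\cap\alpha\in\mathcal{C}_\alpha$ for all $\alpha\in\mathrm{acc}(D)$. A $\square(\lambda,<\eta)$-sequence is a coherent sequence of length $\lambda$ and width $<\eta$ with no thread. For a coherent sequence $\mathcal{C}$, let $A_{\mathcal{C}}$ be the set of $\alpha<\lambda$ for which there is a club $D_\alpha\subseteq\lambda$ such that for every $\beta\in D_\alpha$, $\alpha\in\bigcup_{C\in\mathcal{C}_\beta}\mathrm{acc}(C)$; $\mathcal{C}$ is full if $A_{\mathcal{C}}$ is unbounded in $\lambda$. A stationary $S\subseteq\lambda$ reflects at $\alpha<\lambda$ if $\mathrm{cf}(\alpha)>\omega$ and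 $S\cap\alpha$ is stationary in $\alpha$; a collection of stationary sets reflects simultaneously if there is one $\alpha<\lambda$ at which all reflect. $\mathrm{Refl}(<\kappa,S)$ says every collection of fewer than $\kappa$ stationary subsets of $S$ reflects simultaneously. *)

theory Defs
  imports Main "HOL-Library.Countable_Set"
begin

text \<open>Convention: the regular cardinal lambda is represented by a well-ordered type 'a
  whose order type is lambda (every proper initial segment is of smaller cardinality).
  Ordinals alpha < lambda are elements of 'a; the ordinal alpha is the set {..<alpha}.\<close>

text \<open>Accumulation points (with the usual convention beta > 0).\<close>
definition acc :: "'a::wellorder set \<Rightarrow> 'a set" where
  "acc A = {\<beta>. (\<exists>a\<in>A. \<beta> \<le> a) \<and> (\<exists>\<gamma>. \<gamma> < \<beta>)
              \<and> (\<forall>\<gamma><\<beta>. \<exists>\<delta>\<in>A. \<gamma> < \<delta> \<and> \<delta> < \<beta>)}"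

definition cofinal_in :: "'a::wellorder set \<Rightarrow> 'a set \<Rightarrow> bool" where
  "cofinal_in X I \<longleftrightarrow> X \<subseteq> I \<and> (\<forall>\<gamma>\<in>I. \<exists>\<delta>\<in>X. \<gamma> \<le> \<delta>)"

text \<open>C is a closed unbounded subset of the initial segment I (I = {..<alpha} or I = UNIV = lambda).\<close>
definition club_on :: "'a::wellorder set \<Rightarrow> 'a set \<Rightarrow> bool" where
  "club_on I C \<longleftrightarrow> cofinal_in C I \<and> (\<forall>\<beta>\<in>I. \<beta> \<in> acc C \<longrightarrow> \<beta> \<in> C)"

definition stationary_on :: "'a::wellorder set \<Rightarrow> 'a set \<Rightarrow> bool" where
  "stationary_on I S \<longleftrightarrow> S \<subseteq> I \<and> (\<forall>C. club_on I C \<longrightarrow> C \<inter> S \<noteq> {})"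

definition uncountable_cof :: "'a::wellorder \<Rightarrow> bool" where
  "uncountable_cof \<alpha> \<longleftrightarrow> \<not> (\<exists>X. countable X \<and> cofinal_in X {..<\<alpha>})"

definition is_succ_of :: "'a::wellorder \<Rightarrow> 'a \<Rightarrow> bool" where
  "is_succ_of \<alpha> \<beta> \<longleftrightarrow> \<beta> < \<alpha> \<and> \<not> (\<exists>\<gamma>. \<beta> < \<gamma> \<and> \<gamma> < \<alpha>)"

text \<open>"fewer than kappa", kappa represented by an ordinal k < lambda.\<close>
definition fewer_than :: "'b set \<Rightarrow> 'a::wellorder \<Rightarrow> bool" where
  "fewer_than X k \<longleftrightarrow> (card_of X, card_of {..<k}) \<in> ordLess"

definition is_cardinal_ord :: "'a::wellorder \<Rightarrow> bool" where
  "is_cardinal_ord k \<longleftrightarrow> (\<forall>\<beta><k. (card_of {..<\<beta>}, card_of {..<k}) \<in> ordLess)"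

definition regular_uncountable_type :: "'a::wellorder itself \<Rightarrow> bool" where
  "regular_uncountable_type _ \<longleftrightarrow>
     \<not> countable (UNIV :: 'a set)
   \<and> (\<forall>\<alpha>::'a. (card_of {..<\<alpha>}, card_of (UNIV :: 'a set)) \<in> ordLess)
   \<and> (\<forall>X::'a set. cofinal_in X UNIV \<longrightarrow> (card_of X, card_of (UNIV :: 'a set)) \<notin> ordLess)"

definition coherent_seq :: "'a::wellorder \<Rightarrow> ('a \<Rightarrow> 'a set set) \<Rightarrow> bool" where
  "coherent_seq k \<C> \<longleftrightarrow>
     (\<forall>\<alpha>. \<C> \<alpha> \<noteq> {} \<and> (\<forall>C\<in>\<C> \<alpha>. club_on {..<\<alpha>} C) \<and> fewer_than (\<C> \<alpha>) k)
   \<and> (\<forall>\<alpha> \<beta>. is_succ_of \<alpha> \<beta> \<longrightarrow> \<C> \<alpha> = {{\<beta>}})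
   \<and> (\<forall>\<beta>. \<forall>C\<in>\<C> \<beta>. \<forall>\<alpha>\<in>acc C. C \<inter> {..<\<alpha>} \<in> \<C> \<alpha>)"

definition is_thread :: "('a::wellorder \<Rightarrow> 'a set set) \<Rightarrow> 'a set \<Rightarrow> bool" where
  "is_thread \<C> D \<longleftrightarrow> club_on UNIV D \<and> (\<forall>\<alpha>\<in>acc D. D \<inter> {..<\<alpha>} \<in> \<C> \<alpha>)"

definition square_seq :: "'a::wellorder \<Rightarrow> ('a \<Rightarrow> 'a set set) \<Rightarrow> bool" where
  "square_seq k \<C> \<longleftrightarrow> coherent_seq k \<C> \<and> \<not> (\<exists>D. is_thread \<C> D)"

definition A_set :: "('a::wellorder \<Rightarrow> 'a set set) \<Rightarrow> 'a set" where
  "A_set \<C> = {\<alpha>. \<exists>D. club_on UNIV D \<and> (\<forall>\<beta>\<in>D. \<alpha> \<in> (\<Union>C\<in>\<C> \<beta>. acc C))}"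

definition full :: "('a::wellorder \<Rightarrow> 'a set set) \<Rightarrow> bool" where
  "full \<C> \<longleftrightarrow> cofinal_in (A_set \<C>) UNIV"

definition reflects_simul :: "'a::wellorder set set \<Rightarrow> bool" where
  "reflects_simul \<S> \<longleftrightarrow> (\<exists>\<alpha>. uncountable_cof \<alpha> \<and>
      (\<forall>T\<in>\<S>. stationary_on {..<\<alpha>} (T \<inter> {..<\<alpha>})))"

definition Refl :: "'a::wellorder \<Rightarrow> 'a set \<Rightarrow> bool" where
  "Refl k S \<longleftrightarrow> (\<forall>\<S>. (\<forall>T\<in>\<S>. T \<subseteq> S \<and> stationary_on UNIV T) \<and> fewer_than \<S> k
                     \<longrightarrow> reflects_simul \<S>)"

end

theory Submission
  imports Defs
begin

text \<open>
  Suppose \<open>Refl k S\<close>. For \<open>\<alpha> \<in> A_set \<C>\<close> the fewer than \<open>k\<close> sets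
  of those \<open>\<beta> \<in> S\<close> at which \<open>E \<in> \<C> \<alpha>\<close> is not an initial segment of a member
  of \<open>\<C> \<beta>\<close> cannot reflect simultaneously, so some \<open>E\<^sub>\<alpha> \<in> \<C> \<alpha>\<close> is
  an initial segment of a member of \<open>\<C> \<beta>\<close> for almost all \<open>\<beta> \<in> S\<close>.
  The sets \<open>E\<^sub>\<alpha>\<close> are tree-ordered by end-extension. Given an antichain of size
  at most \<open>k\<close>, one \<open>\<beta> \<in> S\<close> works for all its members, so it injects into
  \<open>\<C> \<beta>\<close>; hence all antichains have size less than \<open>k\<close>. A tree of
  this kind of size \<open>\<lambda> > k\<close> has a cofinal branch, and its union is a thread.
\<close>

unbundle cardinal_syntax

section \<open>Clubs and suprema\<close>

lemma small_bounded:
  fixes X :: "'a::wellorder set"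
  assumes "regular_uncountable_type TYPE('a)" "|X| <o |UNIV :: 'a set|"
  shows "\<exists>z. \<forall>x\<in>X. x < z"
proof -
  have "\<not> cofinal_in X UNIV"
    using assms unfolding regular_uncountable_type_def by blast
  then show ?thesis
    unfolding cofinal_in_def by (auto simp: not_le)
qed

lemma small_image_bounded:
  fixes f :: "'b \<Rightarrow> 'a::wellorder"
  assumes "regular_uncountable_type TYPE('a)" "|X| <o |UNIV :: 'a set|"
  shows "\<exists>z. \<forall>x\<in>X. f x < z"
  using small_bounded[OF assms(1), of "f ` X"] card_of_image[of f X] assms(2)
  by (auto dest: ordLeq_ordLess_trans)

lemma segment_small:
  assumes "regular_uncountable_type TYPE('a::wellorder)"
  shows "|{..<i::'a}| <o |UNIV :: 'a set|"
  using assms unfolding regular_uncountable_type_def by blast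

lemma countable_small:
  assumes "regular_uncountable_type TYPE('a::wellorder)" "countable X"
  shows "|X| <o |UNIV :: 'a set|"
proof (rule ccontr)
  assume "\<not> |X| <o |UNIV :: 'a set|"
  then have "|UNIV :: 'a set| \<le>o |X|"
    by (meson card_of_Well_order not_ordLess_iff_ordLeq)
  then obtain f :: "'a \<Rightarrow> 'b" where "inj_on f UNIV" "f ` UNIV \<subseteq> X"
    using card_of_ordLeq[of "UNIV :: 'a set" X] by blast
  then have "countable (UNIV :: 'a set)"
    using assms(2) by (meson countable_image_inj_on countable_subset)
  then show False
    using assms(1) unfolding regular_uncountable_type_def by blast
qed

lemma ex_greater:
  assumes "regular_uncountable_type TYPE('a::wellorder)"
  shows "\<exists>z::'a. x < z"
  using small_bounded[OF assms countable_small[OF assms, of "{x}"]] by auto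

text \<open>The supremum of the sequence is its least upper bound; it exceeds every
  \<open>s n\<close> because the sequence has no last term.\<close>

lemma omega_sup:
  fixes s :: "nat \<Rightarrow> 'a::wellorder"
  assumes "\<And>n. s n < s (Suc n)" "\<And>n. s n < z"
  obtains \<delta> where "\<delta> \<le> z" "\<And>n. s n < \<delta>" "\<And>\<xi>. \<xi> < \<delta> \<Longrightarrow> \<exists>n. \<xi> < s n"
proof
  let ?P = "\<lambda>d. \<forall>n. s n \<le> d"
  define \<delta> where "\<delta> = (LEAST d. ?P d)"
  have P: "?P \<delta>"
    unfolding \<delta>_def using assms(2) by (intro LeastI[of ?P z]) (auto intro: less_imp_le)
  show "\<delta> \<le> z"
    unfolding \<delta>_def using assms(2) by (intro Least_le) (auto intro: less_imp_le)
  show "s n < \<delta>" for n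
    using P assms(1) by (meson less_le_trans)
  show "\<exists>n. \<xi> < s n" if "\<xi> < \<delta>" for \<xi>
    using not_less_Least[of \<xi> ?P] that unfolding \<delta>_def[symmetric] by (auto simp: not_le)
qed

lemma acc_mono:
  "A \<subseteq> B \<Longrightarrow> acc A \<subseteq> acc B"
  unfolding acc_def by blast

text \<open>Regularity gives a function \<open>g\<close> such that every \<open>D x\<close> meets
  the open interval from \<xi> to \<open>g \<xi>\<close>. The limit of the iterates of
  \<open>g\<close> is then a limit point of all the clubs at once.\<close>

lemma club_INT:
  fixes D :: "'b \<Rightarrow> 'a::wellorder set"
  assumes reg: "regular_uncountable_type TYPE('a)" and small: "|X| <o |UNIV :: 'a set|"
    and club: "\<And>x. x \<in> X \<Longrightarrow> club_on UNIV (D x)"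
  shows "club_on UNIV (\<Inter>x\<in>X. D x)"
  unfolding club_on_def cofinal_in_def
proof (intro conjI ballI impI subset_UNIV)
  fix \<beta> assume "\<beta> \<in> acc (\<Inter>x\<in>X. D x)"
  then have "\<beta> \<in> acc (D x)" if "x \<in> X" for x
    using acc_mono[of "\<Inter>x\<in>X. D x" "D x"] that by blast
  then show "\<beta> \<in> (\<Inter>x\<in>X. D x)"
    using club unfolding club_on_def by blast
next
  fix \<gamma> :: 'a
  have unb: "\<exists>d\<in>D x. \<xi> < d" if x: "x \<in> X" for x \<xi>
  proof -
    obtain z where "\<xi> < z"
      using ex_greater[OF reg] by blast
    moreover obtain d where "d \<in> D x" "z \<le> d"
      using club[OF x] unfolding club_on_def cofinal_in_def by blast
    ultimately show ?thesis
      by (meson less_le_trans)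
  qed
  have "\<exists>z. \<xi> < z \<and> (\<forall>x\<in>X. \<exists>d\<in>D x. \<xi> < d \<and> d < z)" for \<xi>
  proof -
    obtain nx where nx: "\<And>x. x \<in> X \<Longrightarrow> nx x \<in> D x \<and> \<xi> < nx x"
      using unb[of _ \<xi>] by metis
    obtain z where z: "\<forall>x\<in>X. nx x < z"
      using small_image_bounded[OF reg small, of nx] by blast
    obtain w where w: "max \<xi> z < w"
      using ex_greater[OF reg] by blast
    have "\<xi> < w" "nx x < w" if "x \<in> X" for x
      using z w that by (auto dest: bspec)
    then show ?thesis
      using nx w by (intro exI[of _ w]) auto
  qed
  then obtain g where g: "\<And>\<xi>. \<xi> < g \<xi>" "\<And>\<xi> x. x \<in> X \<Longrightarrow> \<exists>d\<in>D x. \<xi> < d \<and> d < g \<xi>"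
    by metis
  define s where "s n = (g ^^ n) \<gamma>" for n
  have s: "s n < s (Suc n)" for n
    unfolding s_def by (simp add: g)
  have "|UNIV :: nat set| <o |UNIV :: 'a set|"
    by (rule countable_small[OF reg]) simp
  then obtain z where "\<And>n. s n < z"
    using small_image_bounded[OF reg, of "UNIV :: nat set" s] by blast
  with s obtain \<delta> where \<delta>: "\<And>n. s n < \<delta>" "\<And>\<xi>. \<xi> < \<delta> \<Longrightarrow> \<exists>n. \<xi> < s n"
    using omega_sup by metis
  have "\<delta> \<in> D x" if x: "x \<in> X" for x
  proof -
    have "\<exists>d\<in>D x. \<xi> < d \<and> d < \<delta>" if \<xi>: "\<xi> < \<delta>" for \<xi>
    proof -
      obtain n where n: "\<xi> < s n"
        using \<delta>(2)[OF \<xi>] by blast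
      obtain d where "d \<in> D x" "s n < d" "d < g (s n)"
        using g(2)[OF x] by blast
      moreover have "g (s n) < \<delta>"
        using \<delta>(1)[of "Suc n"] by (simp add: s_def)
      ultimately show ?thesis
        using n by (meson less_trans)
    qed
    moreover have "\<exists>a\<in>D x. \<delta> \<le> a"
      using unb[OF x] less_imp_le by blast
    ultimately have "\<delta> \<in> acc (D x)"
      unfolding acc_def using \<delta>(1) by blast
    then show ?thesis
      using club[OF x] unfolding club_on_def by blast
  qed
  moreover have "\<gamma> \<le> \<delta>"
    using \<delta>(1)[of 0] by (simp add: s_def)
  ultimately show "\<exists>\<delta>\<in>\<Inter>x\<in>X. D x. \<gamma> \<le> \<delta>"
    by blast
qed

lemma club_Int:
  fixes C D :: "'a::wellorder set"
  assumes "regular_uncountable_type TYPE('a)" "club_on UNIV C" "club_on UNIV D"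
  shows "club_on UNIV (C \<inter> D)"
  using club_INT[OF assms(1) countable_small[OF assms(1)], of "{C, D}" "\<lambda>x. x"] assms(2,3)
  by auto

section \<open>Clubs below an ordinal of uncountable cofinality\<close>

lemma uncountable_cof_no_last:
  assumes "uncountable_cof \<gamma>" "\<xi> < \<gamma>"
  shows "\<exists>\<eta>. \<xi> < \<eta> \<and> \<eta> < \<gamma>"
proof (rule ccontr)
  assume "\<not> ?thesis"
  then have "cofinal_in {\<xi>} {..<\<gamma>}"
    using assms(2) by (auto simp: cofinal_in_def not_less)
  then show False
    using assms(1) by (auto simp: uncountable_cof_def)
qed

lemma club_tail:
  assumes "uncountable_cof \<gamma>" "\<alpha> < \<gamma>"
  shows "club_on {..<\<gamma>} {\<alpha><..<\<gamma>}"
  unfolding club_on_def cofinal_in_def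
proof (intro conjI ballI impI)
  fix \<xi> assume "\<xi> \<in> {..<\<gamma>}"
  then have "max \<xi> \<alpha> < \<gamma>"
    using assms(2) by simp
  then show "\<exists>\<delta>\<in>{\<alpha><..<\<gamma>}. \<xi> \<le> \<delta>"
    using uncountable_cof_no_last[OF assms(1)] by (metis greaterThanLessThan_iff less_imp_le max_less_iff_conj)
next
  fix \<beta> assume "\<beta> \<in> {..<\<gamma>}" "\<beta> \<in> acc {\<alpha><..<\<gamma>}"
  then show "\<beta> \<in> {\<alpha><..<\<gamma>}"
    unfolding acc_def by force
qed auto

text \<open>Unboundedness climbs \<omega> steps through \<open>C\<close>: uncountable cofinality
  keeps the limit below \<gamma>. Closure holds because limits of limit points of \<open>C\<close>
  are limit points of \<open>C\<close>.\<close>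

lemma club_acc:
  assumes unc: "uncountable_cof \<gamma>" and club: "club_on {..<\<gamma>} C" and \<alpha>: "\<alpha> < \<gamma>"
  shows "club_on {..<\<gamma>} (acc C \<inter> {\<alpha><..<\<gamma>})"
  unfolding club_on_def cofinal_in_def
proof (intro conjI ballI impI)
  fix \<xi> assume "\<xi> \<in> {..<\<gamma>}"
  then have m: "max \<xi> \<alpha> < \<gamma>"
    using \<alpha> by simp
  have CI: "C \<subseteq> {..<\<gamma>}"
    using club by (simp add: club_on_def cofinal_in_def)
  have "\<exists>d\<in>C. \<zeta> < d" if \<zeta>: "\<zeta> < \<gamma>" for \<zeta>
  proof -
    obtain \<eta> where "\<zeta> < \<eta>" "\<eta> < \<gamma>"
      using uncountable_cof_no_last[OF unc \<zeta>] by blast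
    moreover from this obtain d where "d \<in> C" "\<eta> \<le> d"
      using club unfolding club_on_def cofinal_in_def by blast
    ultimately show ?thesis
      by (meson less_le_trans)
  qed
  then obtain g where g: "\<And>\<zeta>. \<zeta> < \<gamma> \<Longrightarrow> g \<zeta> \<in> C \<and> \<zeta> < g \<zeta>"
    by metis
  \<comment> \<open>The extra \<open>g\<close> at the start puts even \<open>s 0\<close> into
    \<open>C\<close> and above both \<xi> and \<alpha>.\<close>
  define s where "s n = (g ^^ n) (g (max \<xi> \<alpha>))" for n
  have sC: "s n \<in> C" for n
    unfolding s_def using g m CI by (induction n) auto
  then have s\<gamma>: "s n < \<gamma>" for n
    using CI by blast
  have s: "s n < s (Suc n)" for n
    using g[OF s\<gamma>[of n]] by (simp add: s_def)
  have "\<not> cofinal_in (range s) {..<\<gamma>}"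
    using unc by (auto simp: uncountable_cof_def)
  then obtain z where "z < \<gamma>" "\<And>n. s n < z"
    using s\<gamma> by (auto simp: cofinal_in_def not_le)
  with s obtain \<delta> where \<delta>: "\<delta> \<le> z" "\<And>n. s n < \<delta>" "\<And>\<xi>. \<xi> < \<delta> \<Longrightarrow> \<exists>n. \<xi> < s n"
    using omega_sup by metis
  have \<delta>\<gamma>: "\<delta> < \<gamma>"
    using \<delta>(1) \<open>z < \<gamma>\<close> by simp
  then have "\<exists>a\<in>C. \<delta> \<le> a"
    using club unfolding club_on_def cofinal_in_def by blast
  then have "\<delta> \<in> acc C"
    unfolding acc_def using \<delta>(2,3) sC by blast
  moreover have "max \<xi> \<alpha> < \<delta>"
    using g[OF m] \<delta>(2)[of 0] unfolding s_def by (auto intro: less_trans[of _ "g (max \<xi> \<alpha>)"])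
  ultimately show "\<exists>\<delta>\<in>acc C \<inter> {\<alpha><..<\<gamma>}. \<xi> \<le> \<delta>"
    using \<delta>\<gamma> by (intro bexI[of _ \<delta>]) auto
next
  fix \<beta> assume \<beta>: "\<beta> \<in> {..<\<gamma>}" "\<beta> \<in> acc (acc C \<inter> {\<alpha><..<\<gamma>})"
  have acc: "\<exists>\<delta>\<in>acc C. \<alpha> < \<delta> \<and> \<xi> < \<delta> \<and> \<delta> < \<beta>" if "\<xi> < \<beta>" for \<xi>
    using \<beta>(2) that unfolding acc_def[of "acc C \<inter> {\<alpha><..<\<gamma>}"] by fastforce
  obtain \<xi>\<^sub>0 where "\<xi>\<^sub>0 < \<beta>"
    using \<beta>(2) by (auto simp: acc_def)
  then have "\<alpha> < \<beta>"
    using acc less_trans by blast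
  moreover have "\<exists>\<epsilon>\<in>C. \<xi> < \<epsilon> \<and> \<epsilon> < \<beta>" if \<xi>: "\<xi> < \<beta>" for \<xi>
  proof -
    obtain \<delta> where "\<delta> \<in> acc C" "\<xi> < \<delta>" "\<delta> < \<beta>"
      using acc[OF \<xi>] by blast
    moreover from this obtain \<epsilon> where "\<epsilon> \<in> C" "\<xi> < \<epsilon>" "\<epsilon> < \<delta>"
      unfolding acc_def by blast
    ultimately show ?thesis
      by (meson less_trans)
  qed
  moreover have "\<exists>a\<in>C. \<beta> \<le> a"
    using club \<beta>(1) unfolding club_on_def cofinal_in_def by blast
  ultimately show "\<beta> \<in> acc C \<inter> {\<alpha><..<\<gamma>}"
    using \<beta>(1) \<open>\<xi>\<^sub>0 < \<beta>\<close> unfolding acc_def[of C] by auto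
qed auto

section \<open>Cofinal branches of trees with small antichains\<close>

text \<open>A tree order contained in the order of the ordinals, hence well-founded.
  \<open>R_tree\<close> makes the predecessors of a node comparable; the premise
  \<open>x < y\<close> fixes the direction. Since \<open>R_less\<close> makes \<open>R\<close>
  irreflexive, the case \<open>x = y\<close> in \<open>antichain\<close> is harmless.\<close>

locale tree_on =
  fixes A :: "'a::wellorder set" and R :: "'a \<Rightarrow> 'a \<Rightarrow> bool"
  assumes R_less: "x \<in> A \<Longrightarrow> y \<in> A \<Longrightarrow> R x y \<Longrightarrow> x < y"
    and R_trans: "x \<in> A \<Longrightarrow> y \<in> A \<Longrightarrow> z \<in> A \<Longrightarrow> R x y \<Longrightarrow> R y z \<Longrightarrow> R x z"
    and R_tree: "x \<in> A \<Longrightarrow> y \<in> A \<Longrightarrow> z \<in> A \<Longrightarrow> R x z \<Longrightarrow> R y z \<Longrightarrow> x < y \<Longrightarrow> R x y"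
begin

definition antichain :: "'a set \<Rightarrow> bool" where
  "antichain X \<longleftrightarrow> X \<subseteq> A \<and> (\<forall>x\<in>X. \<forall>y\<in>X. \<not> R x y)"

definition minimals :: "'a set \<Rightarrow> 'a set" where
  "minimals N = {x\<in>N. \<forall>y\<in>N. \<not> R y x}"

lemma antichain_minimals: "N \<subseteq> A \<Longrightarrow> antichain (minimals N)"
  unfolding antichain_def minimals_def by blast

lemma minimal_below:
  assumes "N \<subseteq> A" "x \<in> N"
  shows "\<exists>m\<in>minimals N. m = x \<or> R m x"
  using assms(2)
proof (induction x rule: less_induct)
  case (less x)
  show ?case
  proof (cases "x \<in> minimals N")
    case False
    then obtain y where y: "y \<in> N" "R y x"
      using less.prems unfolding minimals_def by blast
    then obtain m where "m \<in> minimals N" "m = y \<or> R m y"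
      using less R_less assms(1) by blast
    moreover have "minimals N \<subseteq> N"
      by (auto simp: minimals_def)
    ultimately show ?thesis
      using y R_trans[of m y x] less.prems assms(1) by (intro bexI[of _ m]) auto
  qed blast
qed

text \<open>Without a cofinal chain every node that is high enough splits. Following the branch
  below one very high node through \<open>k\<close> stages and stepping off it at each stage
  produces an antichain of size \<open>k\<close>.\<close>

lemma cofinal_chain:
  fixes k :: 'a
  assumes reg: "regular_uncountable_type TYPE('a)" and unb: "cofinal_in A UNIV"
    and small: "\<And>X. antichain X \<Longrightarrow> fewer_than X k"
  shows "\<exists>B\<subseteq>A. cofinal_in B UNIV \<and> (\<forall>x\<in>B. \<forall>y\<in>B. x < y \<longrightarrow> R x y)"
proof (rule ccontr)
  assume no_chain: "\<not> ?thesis"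
  have anti_small: "|X| <o |UNIV :: 'a set|" if "antichain X" for X
    using small[OF that] segment_small[OF reg, of k] unfolding fewer_than_def
    by (rule ordLess_transitive)
  \<comment> \<open>The nodes with boundedly many extensions. Each lies at or above a minimal one,
    and the minimal ones form a small antichain, so regularity bounds all of \<open>N\<close> by
    \<open>z0\<close>.\<close>
  define N where "N = {x\<in>A. \<exists>z. \<forall>y\<in>A. R x y \<longrightarrow> y \<le> z}"
  have NA: "N \<subseteq> A"
    by (auto simp: N_def)
  have "\<exists>z. \<forall>y\<in>A. R x y \<longrightarrow> y \<le> z" if "x \<in> N" for x
    using that unfolding N_def by blast
  then obtain b where b: "\<And>x y. x \<in> N \<Longrightarrow> y \<in> A \<Longrightarrow> R x y \<Longrightarrow> y \<le> b x"
    by metis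
  obtain z0 where z0: "\<forall>x\<in>minimals N. max x (b x) < z0"
    using small_image_bounded[OF reg anti_small[OF antichain_minimals[OF NA]],
      of "\<lambda>x. max x (b x)"] by blast
  have N_bounded: "x < z0" if x: "x \<in> N" for x
  proof -
    obtain m where m: "m \<in> minimals N" "m = x \<or> R m x"
      using minimal_below[OF NA x] by blast
    then have "x \<le> max m (b m)"
      using b[of m x] NA x by (auto simp: minimals_def le_max_iff_disj)
    then show ?thesis
      using z0 m(1) by (meson le_less_trans)
  qed
  \<comment> \<open>If \<open>x\<close> did not split, its extensions, which are unbounded because
    \<open>x\<close> is not in \<open>N\<close>, would form a cofinal chain.\<close>
  have "\<exists>u v. u \<in> A \<and> v \<in> A \<and> R x u \<and> R x v \<and> u < v \<and> \<not> R u v" if x: "x \<in> A" "z0 \<le> x" for x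
  proof (rule ccontr)
    assume contra: "\<not> ?thesis"
    have "x \<notin> N"
      using N_bounded x(2) by (auto simp: not_less[symmetric])
    then have "\<exists>y\<in>A. R x y \<and> z \<le> y" for z
      using x(1) unfolding N_def by (auto simp: not_le intro: less_imp_le)
    then have "cofinal_in {y\<in>A. R x y} UNIV"
      by (auto simp: cofinal_in_def)
    moreover have "R y y'" if "y \<in> {y\<in>A. R x y}" "y' \<in> {y\<in>A. R x y}" "y < y'" for y y'
      using contra that by blast
    moreover have "{y\<in>A. R x y} \<subseteq> A"
      by blast
    ultimately show False
      using no_chain by meson
  qed
  then obtain u v where uv: "\<And>x. x \<in> A \<Longrightarrow> z0 \<le> x \<Longrightarrow>
      u x \<in> A \<and> v x \<in> A \<and> R x (u x) \<and> R x (v x) \<and> u x < v x \<and> \<not> R (u x) (v x)"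
    by metis
  \<comment> \<open>\<open>L \<xi>\<close> collects the roots of the part of the tree from \<xi> on.
    It is an antichain, so \<open>g \<xi>\<close> can bound the splitting nodes \<open>v x\<close>
    of all its members.\<close>
  define L where "L \<xi> = minimals {x\<in>A. \<xi> \<le> x}" for \<xi>
  have "|L \<xi>| <o |UNIV :: 'a set|" for \<xi>
    unfolding L_def by (intro anti_small antichain_minimals) auto
  then have "\<exists>z. \<forall>x\<in>L \<xi>. v x < z" for \<xi>
    using small_image_bounded[OF reg, of "L \<xi>" v] by blast
  then obtain g where g: "\<And>\<xi> x. x \<in> L \<xi> \<Longrightarrow> v x < g \<xi>"
    by metis
  \<comment> \<open>Stages by well-founded recursion: the bound \<open>z0\<close> makes the roots of
    each stage split, and a splitting found at stage \<open>j\<close> lies below every later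
    stage.\<close>
  have "\<exists>s. \<forall>i::'a. z0 \<le> s i \<and> (\<forall>j<i. g (s j) \<le> s i)"
  proof (rule dependent_wf_choice[of "{(x::'a, y). x < y}" "\<lambda>s i r. z0 \<le> r \<and> (\<forall>j<i. g (s j) \<le> r)"])
    show "wf {(x::'a, y). x < y}"
      by (rule wf)
    fix i :: 'a and s
    obtain z where z: "\<forall>j\<in>{..<i}. g (s j) < z"
      using small_image_bounded[OF reg segment_small[OF reg], of i "\<lambda>j. g (s j)"] by blast
    then show "\<exists>r. z0 \<le> r \<and> (\<forall>j<i. g (s j) \<le> r)"
      by (intro exI[of _ "max z0 z"]) (auto simp: le_max_iff_disj less_imp_le)
  qed auto
  then obtain s :: "'a \<Rightarrow> 'a" where s: "\<And>i. z0 \<le> s i" "\<And>i j. j < i \<Longrightarrow> g (s j) \<le> s i"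
    by blast
  obtain z where z: "\<forall>i\<in>{..<k}. max (s i) (g (s i)) < z"
    using small_image_bounded[OF reg segment_small[OF reg], of k "\<lambda>i. max (s i) (g (s i))"] by blast
  obtain x where x: "x \<in> A" "z \<le> x"
    using unb by (auto simp: cofinal_in_def)
  \<comment> \<open>Every \<open>p i\<close> splits before stage \<open>s j\<close> for \<open>j > i\<close>. Hence some extension \<open>t i\<close> of
    \<open>p i\<close> leaves the branch below \<open>x\<close> before \<open>p j\<close>, and the \<open>t i\<close> form an antichain.\<close>
  have "\<exists>p t. p \<in> A \<and> t \<in> A \<and> s i \<le> p \<and> R p x \<and> R p t \<and> \<not> R t x \<and> t < g (s i)"
    if i: "i < k" for i
  proof -
    have six: "s i \<le> x" "g (s i) \<le> x"
      using z i x(2) by (auto dest!: bspec[of _ _ i])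
    obtain p where p: "p \<in> L (s i)" "p = x \<or> R p x"
      using minimal_below[of "{x\<in>A. s i \<le> x}" x] x(1) six(1) unfolding L_def by blast
    have pA: "p \<in> A" "s i \<le> p"
      using p(1) by (auto simp: L_def minimals_def)
    then have pz: "z0 \<le> p"
      using s(1) order_trans by blast
    note uvp = uv[OF pA(1) pz]
    have v: "v p < g (s i)" "u p < g (s i)"
      using g[OF p(1)] uvp by auto
    \<comment> \<open>The case \<open>p = x\<close> is excluded because
      \<open>p < v p < g (s i) \<le> x\<close>.\<close>
    have "R p x"
      using p(2) v six uvp R_less[of p "v p"] pA by auto
    \<comment> \<open>Two predecessors of \<open>x\<close> would be comparable, while
      \<open>u p\<close> and \<open>v p\<close> are not. The one that is not below \<open>x\<close>
      serves as \<open>t\<close>.\<close>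
    moreover have "\<not> R (u p) x \<or> \<not> R (v p) x"
      using uvp R_tree x(1) by blast
    ultimately show ?thesis
      using v uvp pA by blast
  qed
  then obtain p t where
    pt: "\<And>i. i < k \<Longrightarrow> p i \<in> A \<and> t i \<in> A \<and> s i \<le> p i \<and> R (p i) x \<and> R (p i) (t i)
          \<and> \<not> R (t i) x \<and> t i < g (s i)"
    by metis
  have key: "t i < t j \<and> \<not> R (t i) (t j)" if ij: "i < j" "j < k" for i j
  proof -
    have ik: "i < k"
      using ij by simp
    have tp: "t i < p j"
      using pt[OF ik] pt[OF ij(2)] s(2)[OF ij(1)] by (meson less_le_trans)
    \<comment> \<open>Otherwise \<open>t i\<close> and \<open>p j\<close> both precede
      \<open>t j\<close>, so \<open>t i\<close> precedes \<open>p j\<close> and therefore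
      \<open>x\<close>, contrary to the choice of \<open>t i\<close>.\<close>
    have "\<not> R (t i) (t j)"
      using R_tree[of "t i" "p j" "t j"] R_trans[of "t i" "p j" x] tp pt[OF ik] pt[OF ij(2)] x(1)
      by blast
    moreover have "t i < t j"
      using tp R_less[of "p j" "t j"] pt[OF ij(2)] by auto
    ultimately show ?thesis
      by simp
  qed
  have "antichain (t ` {..<k})"
    unfolding antichain_def
  proof (intro conjI ballI)
    fix y y' assume "y \<in> t ` {..<k}" "y' \<in> t ` {..<k}"
    then obtain i j where ij: "i < k" "j < k" "y = t i" "y' = t j"
      by auto
    then show "\<not> R y y'"
      using key[of i j] key[of j i] R_less[of "t i" "t j"] pt[of i] pt[of j]
      by (cases i j rule: linorder_cases) (auto dest: less_asym)
  qed (use pt in auto)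
  then have "|t ` {..<k}| <o |{..<k}|"
    using small unfolding fewer_than_def by blast
  moreover have "inj_on t {..<k}"
    by (rule linorder_inj_onI) (use key in force)+
  then have "|{..<k}| \<le>o |t ` {..<k}|"
    using card_of_ordLeq by blast
  ultimately show False
    using not_ordLess_ordLeq by blast
qed

end

section \<open>Threads from simultaneous reflection\<close>

text \<open>Membership in \<open>acc\<close> requires an element of the set at or above the point.
  As \<open>y\<close> is a limit of \<open>C\<close>, some element of \<open>C\<close> between
  \<open>x\<close> and \<open>y\<close> survives the truncation.\<close>

lemma acc_Int_segment:
  assumes "x \<in> acc C" "y \<in> acc C" "x < y"
  shows "x \<in> acc (C \<inter> {..<y})"
proof -
  obtain a where "a \<in> C" "x < a" "a < y"
    using assms(2,3) by (auto simp: acc_def)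
  then have "\<exists>a\<in>C \<inter> {..<y}. x \<le> a"
    by (intro bexI[of _ a]) auto
  moreover have "\<exists>\<delta>\<in>C \<inter> {..<y}. \<xi> < \<delta> \<and> \<delta> < x" if \<xi>: "\<xi> < x" for \<xi>
  proof -
    obtain \<delta> where "\<delta> \<in> C" "\<xi> < \<delta>" "\<delta> < x"
      using assms(1) \<xi> unfolding acc_def by blast
    then show ?thesis
      using assms(3) by (intro bexI[of _ \<delta>]) auto
  qed
  ultimately show ?thesis
    using assms(1) unfolding acc_def by blast
qed

lemma coherent_seqD:
  assumes "coherent_seq k \<C>"
  shows coherent_nonempty: "\<C> \<alpha> \<noteq> {}"
    and coherent_small: "|\<C> \<alpha>| <o |{..<k}|"
    and coherent_club: "C \<in> \<C> \<alpha> \<Longrightarrow> club_on {..<\<alpha>} C"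
    and coherent_subset: "C \<in> \<C> \<alpha> \<Longrightarrow> C \<subseteq> {..<\<alpha>}"
    and coherent_initial: "C \<in> \<C> \<beta> \<Longrightarrow> \<alpha> \<in> acc C \<Longrightarrow> C \<inter> {..<\<alpha>} \<in> \<C> \<alpha>"
  using assms by (simp_all add: coherent_seq_def fewer_than_def club_on_def cofinal_in_def)

text \<open>If every \<open>E\<close> failed on a stationary set, all these sets would reflect at
  one \<gamma>. Some \<open>C\<close> in \<open>\<C> \<gamma>\<close> has \<alpha> as a limit point,
  and by coherence its trace on \<alpha> works at every later limit point of \<open>C\<close>, which
  are club many points below \<gamma>.\<close>

lemma Refl_almost_all_extend:
  fixes k :: "'a::wellorder"
  assumes reg: "regular_uncountable_type TYPE('a)"
    and coh: "coherent_seq k \<C>" and refl: "Refl k S"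
    and \<alpha>: "\<alpha> \<in> A_set \<C>"
  shows "\<exists>E\<in>\<C> \<alpha>. \<exists>D. club_on UNIV D \<and>
    (\<forall>\<beta>\<in>S \<inter> D. \<exists>C\<in>\<C> \<beta>. \<alpha> \<in> acc C \<and> C \<inter> {..<\<alpha>} = E)"
proof -
  obtain D where D: "club_on UNIV D" "\<And>\<beta>. \<beta> \<in> D \<Longrightarrow> \<exists>C\<in>\<C> \<beta>. \<alpha> \<in> acc C"
    using \<alpha> unfolding A_set_def by blast
  \<comment> \<open>Restricting to \<open>D\<close> makes a reflection point of any
    \<open>T E\<close> a limit of \<open>D\<close>, hence a member of \<open>D\<close>.\<close>
  define T where "T E = {\<beta>\<in>S \<inter> D. \<not> (\<exists>C\<in>\<C> \<beta>. \<alpha> \<in> acc C \<and> C \<inter> {..<\<alpha>} = E)}" for E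
  have "\<exists>E\<in>\<C> \<alpha>. \<not> stationary_on UNIV (T E)"
  proof (rule ccontr)
    assume contra: "\<not> ?thesis"
    have "|T ` \<C> \<alpha>| \<le>o |\<C> \<alpha>|" "|\<C> \<alpha>| <o |{..<k}|"
      by (rule card_of_image, rule coherent_small[OF coh])
    then have "fewer_than (T ` \<C> \<alpha>) k"
      unfolding fewer_than_def by (rule ordLeq_ordLess_trans)
    moreover have "\<forall>X\<in>T ` \<C> \<alpha>. X \<subseteq> S \<and> stationary_on UNIV X"
      using contra by (auto simp: T_def)
    ultimately have "reflects_simul (T ` \<C> \<alpha>)"
      using refl unfolding Refl_def by blast
    then obtain \<gamma> where \<gamma>: "uncountable_cof \<gamma>"
      "\<And>E. E \<in> \<C> \<alpha> \<Longrightarrow> stationary_on {..<\<gamma>} (T E \<inter> {..<\<gamma>})"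
      unfolding reflects_simul_def by blast
    \<comment> \<open>Any member will do: stationarity of a single \<open>T E\<^sub>0\<close> below
      \<gamma> shows that \<open>D\<close> is unbounded there.\<close>
    obtain E\<^sub>0 where E\<^sub>0: "E\<^sub>0 \<in> \<C> \<alpha>"
      using coherent_nonempty[OF coh] by blast
    have "\<exists>\<delta>\<in>D. \<xi> < \<delta> \<and> \<delta> < \<gamma>" if "\<xi> < \<gamma>" for \<xi>
      using \<gamma>(2)[OF E\<^sub>0] club_tail[OF \<gamma>(1) that] unfolding stationary_on_def T_def by fastforce
    moreover have "\<exists>\<xi>. \<xi> < \<gamma>"
      using \<gamma>(1) unfolding uncountable_cof_def cofinal_in_def by auto
    moreover have "\<exists>a\<in>D. \<gamma> \<le> a"
      using D(1) unfolding club_on_def cofinal_in_def by blast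
    ultimately have "\<gamma> \<in> acc D"
      unfolding acc_def by blast
    then have "\<gamma> \<in> D"
      using D(1) unfolding club_on_def by blast
    then obtain C where C: "C \<in> \<C> \<gamma>" "\<alpha> \<in> acc C"
      using D(2) by blast
    have clubC: "club_on {..<\<gamma>} C"
      using coherent_club[OF coh C(1)] .
    have "\<alpha> < \<gamma>"
      using C(2) coherent_subset[OF coh C(1)] by (auto simp: acc_def)
    define E where "E = C \<inter> {..<\<alpha>}"
    have "E \<in> \<C> \<alpha>"
      using coherent_initial[OF coh C] unfolding E_def .
    from \<gamma>(2)[OF this] have "acc C \<inter> {\<alpha><..<\<gamma>} \<inter> (T E \<inter> {..<\<gamma>}) \<noteq> {}"
      using club_acc[OF \<gamma>(1) clubC \<open>\<alpha> < \<gamma>\<close>] unfolding stationary_on_def by simp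
    then obtain \<beta> where \<beta>: "\<beta> \<in> T E" "\<beta> \<in> acc C" "\<alpha> < \<beta>"
      by auto
    have "C \<inter> {..<\<beta>} \<in> \<C> \<beta>"
      using coherent_initial[OF coh C(1) \<beta>(2)] .
    moreover have "\<alpha> \<in> acc (C \<inter> {..<\<beta>})"
      using acc_Int_segment C(2) \<beta>(2,3) by blast
    moreover have "C \<inter> {..<\<beta>} \<inter> {..<\<alpha>} = E"
      using \<beta>(3) unfolding E_def by auto
    ultimately show False
      using \<beta>(1) unfolding T_def by blast
  qed
  then obtain E D' where E: "E \<in> \<C> \<alpha>" "club_on UNIV D'" "D' \<inter> T E = {}"
    unfolding stationary_on_def by blast
  have "\<forall>\<beta>\<in>S \<inter> (D \<inter> D'). \<exists>C\<in>\<C> \<beta>. \<alpha> \<in> acc C \<and> C \<inter> {..<\<alpha>} = E"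
    using E(3) unfolding T_def by blast
  then show ?thesis
    using E(1) club_Int[OF reg D(1) E(2)] by blast
qed

text \<open>The union meets each \<open>x\<close> in \<open>B\<close> exactly in \<open>E x\<close>.
  A limit point of the union is thus a limit point of some \<open>E x\<close>, where closure and
  coherence are available.\<close>

lemma thread_of_cofinal_chain:
  fixes B :: "'a::wellorder set"
  assumes reg: "regular_uncountable_type TYPE('a)"
    and coh: "coherent_seq k \<C>" and unb: "cofinal_in B UNIV"
    and E: "\<And>x. x \<in> B \<Longrightarrow> E x \<in> \<C> x"
    and chain: "\<And>x y. x \<in> B \<Longrightarrow> y \<in> B \<Longrightarrow> x < y \<Longrightarrow> E y \<inter> {..<x} = E x"
  shows "is_thread \<C> (\<Union>x\<in>B. E x)"
proof -
  define D where "D = (\<Union>x\<in>B. E x)"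
  have above: "\<exists>x\<in>B. \<xi> < x" for \<xi>
  proof -
    obtain z where "\<xi> < z"
      using ex_greater[OF reg] by blast
    then show ?thesis
      using unb unfolding cofinal_in_def by (meson UNIV_I less_le_trans)
  qed
  have club: "club_on {..<x} (E x)" if "x \<in> B" for x
    using coherent_club[OF coh E[OF that]] .
  have sub: "E x \<subseteq> {..<x}" if "x \<in> B" for x
    using coherent_subset[OF coh E[OF that]] .
  have D_seg: "D \<inter> {..<x} = E x" if x: "x \<in> B" for x
  proof
    show "E x \<subseteq> D \<inter> {..<x}"
      using x sub unfolding D_def by blast
    show "D \<inter> {..<x} \<subseteq> E x"
    proof
      fix d assume "d \<in> D \<inter> {..<x}"
      then obtain y where y: "y \<in> B" "d \<in> E y" "d < x"
        unfolding D_def by blast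
      show "d \<in> E x"
        using y chain[of x y] chain[of y x] x by (cases x y rule: linorder_cases) auto
    qed
  qed
  have acc_D: "\<exists>x\<in>B. \<beta> < x \<and> \<beta> \<in> acc (E x)" if \<beta>: "\<beta> \<in> acc D" for \<beta>
  proof -
    obtain x where x: "x \<in> B" "\<beta> < x"
      using above by blast
    have "\<exists>a\<in>E x. \<beta> \<le> a"
      using club[OF x(1)] x(2) unfolding club_on_def cofinal_in_def by blast
    moreover have "\<exists>\<delta>\<in>E x. \<xi> < \<delta> \<and> \<delta> < \<beta>" if \<xi>: "\<xi> < \<beta>" for \<xi>
    proof -
      obtain \<delta> where "\<delta> \<in> D" "\<xi> < \<delta>" "\<delta> < \<beta>"
        using \<beta> \<xi> unfolding acc_def by blast
      then show ?thesis
        unfolding D_seg[OF x(1), symmetric] using x(2) by (intro bexI[of _ \<delta>]) auto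
    qed
    moreover have "\<exists>\<xi>. \<xi> < \<beta>"
      using \<beta> unfolding acc_def by blast
    ultimately have "\<beta> \<in> acc (E x)"
      unfolding acc_def by blast
    then show ?thesis
      using x by blast
  qed
  have "club_on UNIV D"
    unfolding club_on_def cofinal_in_def
  proof (intro conjI ballI impI subset_UNIV)
    fix \<xi>
    obtain x where x: "x \<in> B" "\<xi> < x"
      using above by blast
    then show "\<exists>\<delta>\<in>D. \<xi> \<le> \<delta>"
      using club[OF x(1)] unfolding club_on_def cofinal_in_def D_def by blast
  next
    fix \<beta> assume "\<beta> \<in> acc D"
    then obtain x where "x \<in> B" "\<beta> < x" "\<beta> \<in> acc (E x)"
      using acc_D by blast
    then show "\<beta> \<in> D"
      using club unfolding club_on_def D_def by blast
  qed
  moreover have "D \<inter> {..<\<beta>} \<in> \<C> \<beta>" if \<beta>: "\<beta> \<in> acc D" for \<beta>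
  proof -
    obtain x where x: "x \<in> B" "\<beta> < x" "\<beta> \<in> acc (E x)"
      using acc_D[OF \<beta>] by blast
    then have "E x \<inter> {..<\<beta>} \<in> \<C> \<beta>"
      using coherent_initial[OF coh] E by blast
    moreover have "D \<inter> {..<\<beta>} = E x \<inter> {..<\<beta>}"
      unfolding D_seg[OF x(1), symmetric] using x(2) by auto
    ultimately show ?thesis
      by simp
  qed
  ultimately show ?thesis
    unfolding is_thread_def D_def by blast
qed

theorem theorem2p11:
  fixes k :: "'a::wellorder" and \<C> :: "'a \<Rightarrow> 'a set set"
  assumes "regular_uncountable_type TYPE('a)"
    and "is_cardinal_ord k" and "\<not> countable {..<k}"
    and "square_seq k \<C>" and "full \<C>"
  shows "\<forall>S. stationary_on UNIV S \<longrightarrow> \<not> Refl k S"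
proof (intro allI impI notI)
  fix S assume stat: "stationary_on UNIV S" and refl: "Refl k S"
  note reg = assms(1)
  define A where "A = A_set \<C>"
  have coh: "coherent_seq k \<C>" and no_thread: "\<not> is_thread \<C> D" for D
    using assms(4) unfolding square_seq_def by auto
  have "\<exists>E D. E \<in> \<C> \<alpha> \<and> club_on UNIV D \<and>
      (\<forall>\<beta>\<in>S \<inter> D. \<exists>C\<in>\<C> \<beta>. \<alpha> \<in> acc C \<and> C \<inter> {..<\<alpha>} = E)" if "\<alpha> \<in> A" for \<alpha>
    using Refl_almost_all_extend[OF reg coh refl] that unfolding A_def by blast
  then obtain E D where E: "\<And>\<alpha>. \<alpha> \<in> A \<Longrightarrow> E \<alpha> \<in> \<C> \<alpha>"
    and D: "\<And>\<alpha>. \<alpha> \<in> A \<Longrightarrow> club_on UNIV (D \<alpha>)"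
    and ED: "\<And>\<alpha> \<beta>. \<alpha> \<in> A \<Longrightarrow> \<beta> \<in> S \<Longrightarrow> \<beta> \<in> D \<alpha> \<Longrightarrow>
        \<exists>C\<in>\<C> \<beta>. \<alpha> \<in> acc C \<and> C \<inter> {..<\<alpha>} = E \<alpha>"
    by (metis IntI)
  \<comment> \<open>End-extension, with the cut at a limit point so that coherence applies.\<close>
  define R where "R x y \<longleftrightarrow> x \<in> acc (E y) \<and> E y \<inter> {..<x} = E x" for x y
  \<comment> \<open>Traces of one set \<open>C\<close> at two of its limit points are comparable.
    This yields both the tree property and the injectivity of \<open>c\<close> below.\<close>
  have R_initial: "R x y"
    if "x \<in> acc C" "y \<in> acc C" "C \<inter> {..<x} = E x" "C \<inter> {..<y} = E y" "x < y" for C x y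
  proof -
    have "E y \<inter> {..<x} = E x"
      unfolding that(3,4)[symmetric] using that(5) by auto
    then show ?thesis
      using acc_Int_segment[OF that(1,2,5)] that(4) unfolding R_def by simp
  qed
  interpret tree_on A R
  proof
    fix x y assume xy: "x \<in> A" "y \<in> A" "R x y"
    have "E y \<subseteq> {..<y}"
      using coherent_subset[OF coh E[OF xy(2)]] .
    then show xy_less: "x < y"
      using xy(3) unfolding R_def acc_def by auto
    fix z assume "R y z"
    then have z: "E z \<inter> {..<y} = E y"
      unfolding R_def by blast
    then have "x \<in> acc (E z)"
      using acc_mono[of "E y" "E z"] xy(3) unfolding R_def by blast
    moreover have "E z \<inter> {..<x} = E y \<inter> {..<x}"
      unfolding z[symmetric] using xy_less by auto
    ultimately show "R x z"
      using xy(3) unfolding R_def by auto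
  next
    fix x y z assume "R x z" "R y z" "x < y"
    then show "R x y"
      using R_initial[of x "E z" y] unfolding R_def by blast
  qed
  have small: "fewer_than X k" if X: "antichain X" for X
  proof (rule ccontr)
    assume "\<not> fewer_than X k"
    then have "|{..<k}| \<le>o |X|"
      unfolding fewer_than_def by (meson card_of_Well_order not_ordLess_iff_ordLeq)
    then obtain f :: "'a \<Rightarrow> 'a" where f: "inj_on f {..<k}" "f ` {..<k} \<subseteq> X"
      using card_of_ordLeq[of "{..<k}" X] by blast
    \<comment> \<open>The antichain itself might have size \<lambda>; a part of size
      \<open>k\<close> is small enough for the clubs \<open>D \<alpha>\<close> to be
      intersected.\<close>
    define Y where "Y = f ` {..<k}"
    have "|Y| <o |UNIV :: 'a set|"
      using card_of_image[of f "{..<k}"] segment_small[OF reg, of k] unfolding Y_def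
      by (rule ordLeq_ordLess_trans)
    moreover have YA: "Y \<subseteq> A"
      using f(2) X unfolding Y_def antichain_def by blast
    ultimately have "club_on UNIV (\<Inter>\<alpha>\<in>Y. D \<alpha>)"
      using club_INT[OF reg] D by blast
    then obtain \<beta> where "\<beta> \<in> S" "\<And>\<alpha>. \<alpha> \<in> Y \<Longrightarrow> \<beta> \<in> D \<alpha>"
      using stat unfolding stationary_on_def by blast
    then have "\<exists>C. C \<in> \<C> \<beta> \<and> \<alpha> \<in> acc C \<and> C \<inter> {..<\<alpha>} = E \<alpha>" if "\<alpha> \<in> Y" for \<alpha>
      using ED YA that by blast
    then obtain c where c: "\<And>\<alpha>. \<alpha> \<in> Y \<Longrightarrow> c \<alpha> \<in> \<C> \<beta> \<and> \<alpha> \<in> acc (c \<alpha>) \<and> c \<alpha> \<inter> {..<\<alpha>} = E \<alpha>"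
      by metis
    \<comment> \<open>A common value of \<open>c\<close> would be one set with both
      \<open>E x\<close> and \<open>E y\<close> as traces, making \<open>x\<close> and
      \<open>y\<close> comparable. So \<open>\<C> \<beta>\<close> would have at least
      \<open>k\<close> members.\<close>
    have "inj_on c Y"
    proof (rule linorder_inj_onI)
      fix x y assume xy: "x < y" "x \<in> Y" "y \<in> Y"
      show "c x \<noteq> c y"
      proof
        assume "c x = c y"
        then have "R x y"
          using R_initial[of x "c y" y] c[of x] c[of y] xy by auto
        then show False
          using X xy f(2) unfolding antichain_def Y_def by blast
      qed
    qed auto
    then have "|Y| \<le>o |\<C> \<beta>|"
      using card_of_ordLeq[of Y "\<C> \<beta>"] c by blast
    moreover have "|{..<k}| \<le>o |Y|"
      using card_of_ordLeq[of "{..<k}" Y] f(1) unfolding Y_def by blast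
    moreover have "|\<C> \<beta>| <o |{..<k}|"
      using coherent_small[OF coh] .
    ultimately show False
      using ordLeq_transitive not_ordLess_ordLeq by blast
  qed
  have "cofinal_in A UNIV"
    using assms(5) unfolding full_def A_def .
  from cofinal_chain[OF reg this small] obtain B where B: "B \<subseteq> A" "cofinal_in B UNIV"
    "\<And>x y. x \<in> B \<Longrightarrow> y \<in> B \<Longrightarrow> x < y \<Longrightarrow> R x y"
    by auto
  have "is_thread \<C> (\<Union>x\<in>B. E x)"
  proof (rule thread_of_cofinal_chain[OF reg coh B(2)])
    show "E x \<in> \<C> x" if "x \<in> B" for x
      using E B(1) that by blast
    show "E y \<inter> {..<x} = E x" if "x \<in> B" "y \<in> B" "x < y" for x y
      using B(3)[OF that] unfolding R_def by simp
  qed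
  then show False
    using no_thread by blast
qed

end
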